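(* Let $N\ge 1$, let $D_0,\dots,D_N$ and $d$ be positive integers with $d\le D_L$ for all $L$, and let $W^{(L)}\in\mathbb{R}^{D_{L+1}\times D_L}$ for $0\le L\le N-1$. For each $0\le L\le N$ let $V_d^{(L)}\in\mathbb{R}^{D_L\times d}$ be a fixed matrix with orthonormal columns (the anchor), where for $0\le L\le N-1$ the columns of $V_d^{(L)}$ span the top-$d$ right singular subspace of $W^{(L)}$. For $\lambda\ge 0$ let $\{S_L^\star(\lambda)\}_{L=0}^{N}$ be the maximizer, over all families $\{S_L\}_{L=0}^N$ with $S_L\in\mathbb{R}^{D_L\times d}$ and $S_L^\top S_L=I_d$, of the energy $$\mathcal{E}_\lambda[S]=\sum_{L=0}^{N-1}\|S_{L+1}^\top W^{(L)}S_L\|_F^2+\lambda\sum_{L=0}^{N}\|S_L^\top V_d^{(L)}\|_F^2 .$$ Let $g_L>0$ be the gap between the $d$-th and $(d+1)$-th eigenvalues (in decreasing order) of $V_d^{(L)}V_d^{(L)\top}$, regarded as a projector on $\mathbb{R}^{D_L}$. Then there is an explicit constant $C$, depending only on the Frobenius norms $\|W^{(L)}\|_F$ and on the architecture of the bundle (number of layers, neighbor connections), such that for all sufficiently large $\lambda$ and each $L$, $$\mathrm{gap}\big(S_L^\star(\lambda),V_d^{(L)}\big)\;\le\;\frac{C}{\lambda\, g_L}+o(1/\lambda)\qquad(\lambda\to\infty).$$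
   Context: $\|\cdot\|_F$ is the Frobenius norm. The matrices $W^{(L)}$ are called teacher weights. A section at interface $L$ is a matrix $S_L\in\mathbb{R}^{D_L\times d}$ with orthonormal columns, $S_L^\top S_L=I_d$; it represents the $d$-dimensional subspace of $\mathbb{R}^{D_L}$ spanned by its columns, i.e. a point of the Grassmannian $\mathrm{Gr}(d,D_L)$. The energy depends only on these subspaces, so maximizers are understood up to change of orthonormal basis of each subspace. For matrices $S,V\in\mathbb{R}^{D_L\times d}$ with orthonormal columns, $\mathrm{gap}(S,V)=\|SS^\top-VV^\top\|_F$ is the Frobenius distance between the corresponding orthogonal projectors. The top-$d$ right singular subspace of a matrix is the span of right singular vectors belonging to its $d$ largest singular values. The "architecture of the bundle" refers to the number of layers $N$ and the fact that each $S_L$ is coupled to $S_{L-1}$ through $W^{(L-1)}$ (if $L\ge1$) and to $S_{L+1}$ through $W^{(L)}$ (if $L\le N-1$). *)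

theory Defs
  imports
    "HOL-Library.Landau_Symbols"
    "Jordan_Normal_Form.VS_Connect"
    "Jordan_Normal_Form.Char_Poly"
begin

definition frob_norm :: "real mat \<Rightarrow> real" where
  "frob_norm A = sqrt (\<Sum>i<dim_row A. \<Sum>j<dim_col A. (A $$ (i, j))\<^sup>2)"

text \<open>Matrices with \<open>n\<close> rows and \<open>k\<close> orthonormal columns. The library's
  \<^const>\<open>orthogonal_mat\<close> only asks for pairwise orthogonal nonzero columns.\<close>

definition orthonormal_cols :: "nat \<Rightarrow> nat \<Rightarrow> real mat set" where
  "orthonormal_cols n k = {S \<in> carrier_mat n k. S\<^sup>T * S = 1\<^sub>m k}"

definition gap :: "real mat \<Rightarrow> real mat \<Rightarrow> real" where
  "gap S V = frob_norm (S * S\<^sup>T - V * V\<^sup>T)"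

definition colspan :: "real mat \<Rightarrow> real vec set" where
  "colspan A = vec_space.col_space (dim_row A) A"

text \<open>A full singular value decomposition \<open>A = U * \<Sigma> * X\<^sup>T\<close> with the singular
  values on the diagonal of \<open>\<Sigma>\<close> in decreasing order; the columns of \<open>X\<close> are the
  right singular vectors.\<close>

definition is_svd :: "real mat \<Rightarrow> real mat \<Rightarrow> real mat \<Rightarrow> real mat \<Rightarrow> bool" where
  "is_svd A U \<Sigma> X \<longleftrightarrow>
     (let m = dim_row A; n = dim_col A in
      U \<in> orthonormal_cols m m \<and> X \<in> orthonormal_cols n n \<and> \<Sigma> \<in> carrier_mat m n \<and>
      (\<forall>i<m. \<forall>j<n. i \<noteq> j \<longrightarrow> \<Sigma> $$ (i, j) = 0) \<and>
      (\<forall>i<min m n. \<Sigma> $$ (i, i) \<ge> 0) \<and>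
      (\<forall>i j. i \<le> j \<longrightarrow> j < min m n \<longrightarrow> \<Sigma> $$ (j, j) \<le> \<Sigma> $$ (i, i)) \<and>
      A = U * \<Sigma> * X\<^sup>T)"

text \<open>A predicate rather than a function: if the \<open>d\<close>-th and \<open>(d+1)\<close>-th singular
  values coincide, the subspace depends on the choice of singular vectors, and every
  choice is admitted.\<close>

definition is_top_right_singular_subspace ::
    "nat \<Rightarrow> real mat \<Rightarrow> real vec set \<Rightarrow> bool" where
  "is_top_right_singular_subspace d A T \<longleftrightarrow>
     (\<exists>U \<Sigma> X. is_svd A U \<Sigma> X \<and> T = colspan (mat_of_cols (dim_col A) (take d (cols X))))"

text \<open>Families are indexed by \<open>0, \<dots>, N\<close>; values at larger indices are irrelevant.\<close>

definition section_families :: "nat \<Rightarrow> (nat \<Rightarrow> nat) \<Rightarrow> nat \<Rightarrow> (nat \<Rightarrow> real mat) set" where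
  "section_families N D d = {S. \<forall>L\<le>N. S L \<in> orthonormal_cols (D L) d}"

definition energy ::
    "nat \<Rightarrow> (nat \<Rightarrow> real mat) \<Rightarrow> (nat \<Rightarrow> real mat) \<Rightarrow> real \<Rightarrow> (nat \<Rightarrow> real mat) \<Rightarrow> real" where
  "energy N W V l S =
     (\<Sum>L<N. (frob_norm ((S (L + 1))\<^sup>T * W L * S L))\<^sup>2)
     + l * (\<Sum>L\<le>N. (frob_norm ((S L)\<^sup>T * V L))\<^sup>2)"

text \<open>Real eigenvalues with algebraic multiplicity (all of them, if \<open>A\<close> is symmetric),
  in decreasing order.\<close>

definition eigenvalues_decreasing :: "real mat \<Rightarrow> real list" where
  "eigenvalues_decreasing A = rev (sorted_list_of_multiset (proots (char_poly A)))"

text \<open>The gap between the \<open>d\<close>-th and \<open>(d+1)\<close>-th eigenvalues, counted from one, for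
  \<open>d \<ge> 1\<close>. If \<open>d\<close> is the size of the matrix there is no \<open>(d+1)\<close>-th eigenvalue; it is
  then read as \<open>0\<close>. So for a rank-\<open>d\<close> orthogonal projector the gap is always \<open>1\<close>.\<close>

definition eigenvalue_gap :: "nat \<Rightarrow> real mat \<Rightarrow> real" where
  "eigenvalue_gap d A =
     (let es = eigenvalues_decreasing A
      in es ! (d - 1) - (if d < length es then es ! d else 0))"

end

theory Submission
  imports Defs "HOL-Analysis.L2_Norm"
begin

text \<open>
  Writing \<open>P\<^sub>L\<close> and \<open>Q\<^sub>L\<close> for the projectors of \<open>S\<^sub>L\<close> and \<open>V\<^sub>L\<close>, one has
  \<open>gap\<^sup>2 = 2 (d - \<parallel>S\<^sub>L\<^sup>T V\<^sub>L\<parallel>\<^sup>2)\<close>, so comparing the energies of the maximizer and of the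
  anchors bounds \<open>\<lambda> / 2\<close> times the sum of all \<open>gap\<^sup>2\<close> by the difference of the coupling terms.
  Each coupling term is the bilinear form \<open>\<langle>P\<^sub>L\<^sub>+\<^sub>1, W P\<^sub>L W\<^sup>T\<rangle>\<close> in the projectors, hence
  that difference is at most the sum of \<open>\<parallel>W\<parallel>\<^sup>2 (gap\<^sub>L\<^sub>+\<^sub>1 + gap\<^sub>L)\<close>. Evaluating at the largest gap
  cancels one factor and gives the bound \<open>4 \<Sum> \<parallel>W\<parallel>\<^sup>2 / \<lambda>\<close>, for every \<open>\<lambda> > 0\<close> and without error
  term. The eigenvalue gap of a rank \<open>d\<close> projector is \<open>1\<close>.
\<close>

section \<open>Frobenius inner product\<close>

text \<open>This is the trace of \<open>A\<^sup>T * B\<close>, written entrywise. The index range is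
  read off \<open>A\<close>, so symmetry has to assume equal shapes.\<close>

definition frob_inner :: "real mat \<Rightarrow> real mat \<Rightarrow> real" where
  "frob_inner A B = (\<Sum>i<dim_row A. \<Sum>j<dim_col A. A $$ (i, j) * B $$ (i, j))"

lemma frob_norm_nonneg: "0 \<le> frob_norm A"
  unfolding frob_norm_def by (intro real_sqrt_ge_zero sum_nonneg) simp

lemma frob_norm_sq: "(frob_norm A)\<^sup>2 = frob_inner A A"
  unfolding frob_norm_def frob_inner_def
  by (subst real_sqrt_pow2) (auto intro!: sum_nonneg simp: power2_eq_square)

lemma frob_norm_L2_set:
  assumes "A \<in> carrier_mat n m"
  shows "frob_norm A = L2_set (\<lambda>p. A $$ p) ({..<n} \<times> {..<m})"
  using assms unfolding frob_norm_def L2_set_def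
  by (simp add: sum.cartesian_product case_prod_beta)

lemma frob_inner_commute:
  assumes "A \<in> carrier_mat n m" "B \<in> carrier_mat n m"
  shows "frob_inner A B = frob_inner B A"
  using assms unfolding frob_inner_def by (simp add: mult.commute)

lemma frob_inner_diff_left:
  assumes "A \<in> carrier_mat n m" "B \<in> carrier_mat n m"
  shows "frob_inner (A - B) C = frob_inner A C - frob_inner B C"
  using assms unfolding frob_inner_def
  by (simp add: sum_subtractf[symmetric] left_diff_distrib)

lemma frob_inner_transpose:
  assumes "A \<in> carrier_mat n m" "B \<in> carrier_mat n m"
  shows "frob_inner A\<^sup>T B\<^sup>T = frob_inner A B"
  using assms unfolding frob_inner_def by (simp add: sum.swap[of _ "{..<m}"])

text \<open>Left multiplication by \<open>A\<close> has left multiplication by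
  \<open>A\<^sup>T\<close> as its adjoint: both sides are the same triple sum in a different
  order.\<close>

lemma frob_inner_mult_left:
  assumes "A \<in> carrier_mat n k" "B \<in> carrier_mat k m" "C \<in> carrier_mat n m"
  shows "frob_inner (A * B) C = frob_inner B (A\<^sup>T * C)"
proof -
  have "frob_inner (A * B) C = (\<Sum>i<n. \<Sum>j<m. \<Sum>l<k. A $$ (i, l) * B $$ (l, j) * C $$ (i, j))"
    using assms unfolding frob_inner_def
    by (simp add: scalar_prod_def sum_distrib_right atLeast0LessThan)
  also have "\<dots> = (\<Sum>i<n. \<Sum>l<k. \<Sum>j<m. A $$ (i, l) * B $$ (l, j) * C $$ (i, j))"
    by (intro sum.cong refl sum.swap)
  also have "\<dots> = (\<Sum>l<k. \<Sum>i<n. \<Sum>j<m. A $$ (i, l) * B $$ (l, j) * C $$ (i, j))"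
    by (rule sum.swap)
  also have "\<dots> = (\<Sum>l<k. \<Sum>j<m. \<Sum>i<n. A $$ (i, l) * B $$ (l, j) * C $$ (i, j))"
    by (intro sum.cong refl sum.swap)
  also have "\<dots> = frob_inner B (A\<^sup>T * C)"
    using assms unfolding frob_inner_def
    by (simp add: scalar_prod_def sum_distrib_left atLeast0LessThan mult_ac)
  finally show ?thesis .
qed

lemma frob_inner_mult_right:
  assumes A: "A \<in> carrier_mat n k" and B: "B \<in> carrier_mat k m" and C: "C \<in> carrier_mat n m"
  shows "frob_inner (A * B) C = frob_inner A (C * B\<^sup>T)"
proof -
  have "frob_inner (A * B) C = frob_inner (B\<^sup>T * A\<^sup>T) C\<^sup>T"
    using frob_inner_transpose[of "A * B" n m C] transpose_mult[OF A B] A B C by simp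
  also have "\<dots> = frob_inner A\<^sup>T (B * C\<^sup>T)"
    using frob_inner_mult_left[of "B\<^sup>T" m k "A\<^sup>T" n "C\<^sup>T"] A B C by simp
  also have "\<dots> = frob_inner A (C * B\<^sup>T)"
    using frob_inner_transpose[of A n k "C * B\<^sup>T"] transpose_mult[of C n m "B\<^sup>T" k] A B C by simp
  finally show ?thesis .
qed

section \<open>Cauchy-Schwarz and submultiplicativity of the Frobenius norm\<close>

lemma frob_inner_le:
  assumes A: "A \<in> carrier_mat n m" and B: "B \<in> carrier_mat n m"
  shows "frob_inner A B \<le> frob_norm A * frob_norm B"
proof -
  have "frob_inner A B = (\<Sum>p\<in>{..<n} \<times> {..<m}. A $$ p * B $$ p)"
    using A unfolding frob_inner_def by (simp add: sum.cartesian_product case_prod_beta)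
  also have "\<dots> \<le> (\<Sum>p\<in>{..<n} \<times> {..<m}. \<bar>A $$ p\<bar> * \<bar>B $$ p\<bar>)"
    by (intro sum_mono) (metis abs_ge_self abs_mult)
  also have "\<dots> \<le> frob_norm A * frob_norm B"
    unfolding frob_norm_L2_set[OF A] frob_norm_L2_set[OF B] by (rule L2_set_mult_ineq)
  finally show ?thesis .
qed

lemma frob_norm_mult_le:
  assumes A: "A \<in> carrier_mat n k" and B: "B \<in> carrier_mat k m"
  shows "frob_norm (A * B) \<le> frob_norm A * frob_norm B"
proof (rule power2_le_imp_le)
  have entry: "((A * B) $$ (i, j))\<^sup>2 \<le> (\<Sum>l<k. (A $$ (i, l))\<^sup>2) * (\<Sum>l<k. (B $$ (l, j))\<^sup>2)"
    if "i < n" "j < m" for i j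
  proof -
    let ?f = "\<lambda>l. A $$ (i, l)" and ?g = "\<lambda>l. B $$ (l, j)"
    have "\<bar>(A * B) $$ (i, j)\<bar> = \<bar>\<Sum>l<k. ?f l * ?g l\<bar>"
      using that A B by (simp add: scalar_prod_def atLeast0LessThan)
    also have "\<dots> \<le> (\<Sum>l<k. \<bar>?f l\<bar> * \<bar>?g l\<bar>)"
      by (simp add: abs_mult[symmetric] sum_abs)
    also have "\<dots> \<le> L2_set ?f {..<k} * L2_set ?g {..<k}"
      by (rule L2_set_mult_ineq)
    finally have "((A * B) $$ (i, j))\<^sup>2 \<le> (L2_set ?f {..<k} * L2_set ?g {..<k})\<^sup>2"
      by (metis abs_ge_zero power2_abs power_mono)
    then show ?thesis
      by (simp add: power_mult_distrib L2_set_def sum_nonneg)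
  qed
  have "(frob_norm (A * B))\<^sup>2 = (\<Sum>i<n. \<Sum>j<m. ((A * B) $$ (i, j))\<^sup>2)"
    using A B by (simp add: frob_norm_def sum_nonneg)
  also have "\<dots> \<le> (\<Sum>i<n. \<Sum>j<m. (\<Sum>l<k. (A $$ (i, l))\<^sup>2) * (\<Sum>l<k. (B $$ (l, j))\<^sup>2))"
    by (intro sum_mono entry) auto
  \<comment> \<open>The entrywise Cauchy-Schwarz bound is a row factor times a column factor, so the
    double sum splits into a product.\<close>
  also have "\<dots> = (\<Sum>i<n. \<Sum>l<k. (A $$ (i, l))\<^sup>2) * (\<Sum>j<m. \<Sum>l<k. (B $$ (l, j))\<^sup>2)"
    by (rule sum_product[symmetric])
  also have "(\<Sum>j<m. \<Sum>l<k. (B $$ (l, j))\<^sup>2) = (\<Sum>l<k. \<Sum>j<m. (B $$ (l, j))\<^sup>2)"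
    by (rule sum.swap)
  also have "(\<Sum>i<n. \<Sum>l<k. (A $$ (i, l))\<^sup>2) * \<dots> = (frob_norm A * frob_norm B)\<^sup>2"
    using A B by (simp add: frob_norm_def sum_nonneg power_mult_distrib)
  finally show "(frob_norm (A * B))\<^sup>2 \<le> (frob_norm A * frob_norm B)\<^sup>2" .
qed (simp add: frob_norm_nonneg)

lemma frob_norm_transpose: "frob_norm A\<^sup>T = frob_norm A"
  unfolding frob_norm_def by (simp add: sum.swap[of _ "{..<dim_col A}"])

section \<open>Orthonormal columns\<close>

lemma orthonormal_colsD:
  assumes "S \<in> orthonormal_cols n d"
  shows "S \<in> carrier_mat n d" "S\<^sup>T * S = 1\<^sub>m d"
  using assms unfolding orthonormal_cols_def by auto

text \<open>Moving both factors across the inner product makes the overlap linear in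
  \<open>S * S\<^sup>T\<close>. It serves the anchor terms, and with \<open>W * S\<close> in place
  of \<open>V\<close> also the coupling terms.\<close>

lemma frob_norm_transpose_mult_sq:
  assumes S: "S \<in> carrier_mat n d" and V: "V \<in> carrier_mat n k"
  shows "(frob_norm (S\<^sup>T * V))\<^sup>2 = frob_inner (S * S\<^sup>T) (V * V\<^sup>T)"
proof -
  have "frob_inner (S\<^sup>T * V) (S\<^sup>T * V) = frob_inner S\<^sup>T (S\<^sup>T * V * V\<^sup>T)"
    by (rule frob_inner_mult_right) (use S V in auto)
  also have "S\<^sup>T * V * V\<^sup>T = S\<^sup>T * (V * V\<^sup>T)"
    by (rule assoc_mult_mat) (use S V in auto)
  also have "frob_inner S\<^sup>T \<dots> = frob_inner (S * S\<^sup>T) (V * V\<^sup>T)"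
    by (rule frob_inner_mult_left[symmetric]) (use S V in auto)
  finally show ?thesis
    by (simp add: frob_norm_sq)
qed

lemma frob_norm_one_sq: "(frob_norm (1\<^sub>m d))\<^sup>2 = real d"
proof -
  have "(frob_norm (1\<^sub>m d))\<^sup>2 = (\<Sum>i<d. \<Sum>j<d. if i = j then 1 else 0)"
    unfolding frob_norm_sq frob_inner_def by (intro sum.cong) auto
  then show ?thesis
    by simp
qed

text \<open>Expanding the square of the difference of two projectors: each has squared norm
  \<open>d\<close>, and the cross term is the overlap.\<close>

lemma gap_sq:
  assumes S: "S \<in> orthonormal_cols n d" and V: "V \<in> orthonormal_cols n d"
  shows "(gap S V)\<^sup>2 = 2 * (real d - (frob_norm (S\<^sup>T * V))\<^sup>2)"
proof -
  note S = orthonormal_colsD[OF S] and V = orthonormal_colsD[OF V]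
  define P where "P = S * S\<^sup>T"
  define Q where "Q = V * V\<^sup>T"
  have PQ: "P \<in> carrier_mat n n" "Q \<in> carrier_mat n n"
    using S V by (auto simp: P_def Q_def)
  have 1: "frob_inner P P = d" "frob_inner Q Q = d"
    using frob_norm_transpose_mult_sq[OF S(1) S(1)] frob_norm_transpose_mult_sq[OF V(1) V(1)]
    by (simp_all add: P_def Q_def S V frob_norm_one_sq)
  have "(gap S V)\<^sup>2 = frob_inner P (P - Q) - frob_inner Q (P - Q)"
    using PQ frob_inner_diff_left[of P n n Q] by (simp add: gap_def frob_norm_sq P_def Q_def)
  also have "frob_inner P (P - Q) = frob_inner P P - frob_inner Q P"
    using PQ by (metis frob_inner_commute frob_inner_diff_left minus_carrier_mat)
  also have "frob_inner Q (P - Q) = frob_inner P Q - frob_inner Q Q"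
    using PQ by (metis frob_inner_commute frob_inner_diff_left minus_carrier_mat)
  also have "frob_inner Q P = frob_inner P Q"
    using PQ by (simp add: frob_inner_commute)
  finally show ?thesis
    using frob_norm_transpose_mult_sq[OF S(1) V(1)] by (simp add: 1 P_def[symmetric] Q_def[symmetric])
qed

text \<open>Since \<open>S\<^sup>T * S\<close> is the identity, \<open>W * S\<close> and
  \<open>W * S * S\<^sup>T\<close> have equal norm. Cauchy-Schwarz for \<open>W\<close> and
  \<open>W * S * S\<^sup>T\<close> then bounds the square of this norm by its product with the norm
  of \<open>W\<close>, and one factor cancels.\<close>

lemma frob_norm_mult_orthonormal_le:
  assumes W: "W \<in> carrier_mat m n" and S: "S \<in> orthonormal_cols n d"
  shows "frob_norm (W * S) \<le> frob_norm W"
proof -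
  note S = orthonormal_colsD[OF S]
  have WS: "W * S \<in> carrier_mat m d" and WST: "W * S * S\<^sup>T \<in> carrier_mat m n"
    using W S by auto
  have "frob_inner (W * S * S\<^sup>T) (W * S * S\<^sup>T) = frob_inner (W * S) (W * S * S\<^sup>T * S)"
    using frob_inner_mult_right[OF WS, of "S\<^sup>T" n "W * S * S\<^sup>T"] S WST by simp
  also have "W * S * S\<^sup>T * S = W * S"
    using WS S assoc_mult_mat[OF WS, of "S\<^sup>T" n S d] by simp
  finally have eq: "frob_norm (W * S * S\<^sup>T) = frob_norm (W * S)"
    by (metis frob_norm_nonneg frob_norm_sq power2_eq_imp_eq)
  have "frob_norm (W * S) * frob_norm (W * S) = frob_inner W (W * S * S\<^sup>T)"
    using frob_inner_mult_right[OF W S(1) WS] frob_norm_sq[of "W * S"]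
    by (simp add: power2_eq_square)
  also have "\<dots> \<le> frob_norm W * frob_norm (W * S)"
    using frob_inner_le[OF W WST] by (simp add: eq)
  finally show ?thesis
    using frob_norm_nonneg[of "W * S"] frob_norm_nonneg[of W]
    by (cases "frob_norm (W * S) = 0") auto
qed

section \<open>The coupling terms\<close>

lemma frob_norm_gram_le:
  assumes W: "W \<in> carrier_mat m n" and S: "S \<in> orthonormal_cols n d"
  shows "frob_norm ((W * S) * (W * S)\<^sup>T) \<le> (frob_norm W)\<^sup>2"
proof -
  have WS: "W * S \<in> carrier_mat m d"
    using W orthonormal_colsD[OF S] by auto
  have "frob_norm ((W * S) * (W * S)\<^sup>T) \<le> frob_norm (W * S) * frob_norm (W * S)"
    using frob_norm_mult_le[OF WS, of "(W * S)\<^sup>T" m] WS by (simp add: frob_norm_transpose)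
  also have "\<dots> \<le> (frob_norm W)\<^sup>2"
    using frob_norm_mult_orthonormal_le[OF W S]
    by (simp add: power2_eq_square mult_mono frob_norm_nonneg)
  finally show ?thesis .
qed

text \<open>With \<open>S\<close> fixed, the coupling is a linear functional of the projector
  \<open>T * T\<^sup>T\<close>, represented by the Gram matrix of \<open>W * S\<close>;
  Cauchy-Schwarz gives the Lipschitz bound.\<close>

lemma coupling_left_diff_le:
  assumes W: "W \<in> carrier_mat m n" and S: "S \<in> orthonormal_cols n d"
    and T: "T \<in> orthonormal_cols m d" and U: "U \<in> orthonormal_cols m d"
  shows "(frob_norm (T\<^sup>T * W * S))\<^sup>2 - (frob_norm (U\<^sup>T * W * S))\<^sup>2 \<le> (frob_norm W)\<^sup>2 * gap T U"
proof -
  note s = orthonormal_colsD[OF S] and t = orthonormal_colsD[OF T] and u = orthonormal_colsD[OF U]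
  have WS: "W * S \<in> carrier_mat m d"
    using W s by auto
  have assoc: "T\<^sup>T * W * S = T\<^sup>T * (W * S)" "U\<^sup>T * W * S = U\<^sup>T * (W * S)"
    using W s t u by (auto intro!: assoc_mult_mat)
  have "(frob_norm (T\<^sup>T * W * S))\<^sup>2 - (frob_norm (U\<^sup>T * W * S))\<^sup>2
      = frob_inner (T * T\<^sup>T - U * U\<^sup>T) ((W * S) * (W * S)\<^sup>T)"
    unfolding assoc frob_norm_transpose_mult_sq[OF t(1) WS] frob_norm_transpose_mult_sq[OF u(1) WS]
    by (rule frob_inner_diff_left[symmetric]) (use t u in auto)
  also have "\<dots> \<le> gap T U * frob_norm ((W * S) * (W * S)\<^sup>T)"
    unfolding gap_def by (rule frob_inner_le) (use t u WS in auto)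
  also have "\<dots> \<le> gap T U * (frob_norm W)\<^sup>2"
    by (intro mult_left_mono frob_norm_gram_le[OF W S]) (simp add: gap_def frob_norm_nonneg)
  finally show ?thesis
    by (simp add: mult.commute)
qed

text \<open>Transposition exchanges the roles of the two sections, so the estimate for the left
  section also covers the right one, with \<open>W\<^sup>T\<close> for \<open>W\<close>.\<close>

lemma coupling_transpose:
  assumes "W \<in> carrier_mat m n" "S \<in> carrier_mat n d" "T \<in> carrier_mat m d"
  shows "frob_norm (S\<^sup>T * W\<^sup>T * T) = frob_norm (T\<^sup>T * W * S)"
proof -
  have "(T\<^sup>T * W * S)\<^sup>T = S\<^sup>T * (T\<^sup>T * W)\<^sup>T"
    by (rule transpose_mult) (use assms in auto)
  also have "(T\<^sup>T * W)\<^sup>T = W\<^sup>T * T"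
    using transpose_mult[of "T\<^sup>T" d m W n] assms by simp
  also have "S\<^sup>T * (W\<^sup>T * T) = S\<^sup>T * W\<^sup>T * T"
    by (rule assoc_mult_mat[symmetric]) (use assms in auto)
  finally show ?thesis
    by (metis frob_norm_transpose)
qed

text \<open>The two sections are exchanged one at a time, through the mixed term
  \<open>U\<^sup>T * W * S\<close>.\<close>

lemma coupling_diff_le:
  assumes W: "W \<in> carrier_mat m n"
    and S: "S \<in> orthonormal_cols n d" and R: "R \<in> orthonormal_cols n d"
    and T: "T \<in> orthonormal_cols m d" and U: "U \<in> orthonormal_cols m d"
  shows "(frob_norm (T\<^sup>T * W * S))\<^sup>2 - (frob_norm (U\<^sup>T * W * R))\<^sup>2
    \<le> (frob_norm W)\<^sup>2 * (gap T U + gap S R)"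
proof -
  have "(frob_norm (S\<^sup>T * W\<^sup>T * U))\<^sup>2 - (frob_norm (R\<^sup>T * W\<^sup>T * U))\<^sup>2 \<le> (frob_norm W\<^sup>T)\<^sup>2 * gap S R"
    by (rule coupling_left_diff_le[OF _ U S R]) (use W in auto)
  moreover have "frob_norm (S\<^sup>T * W\<^sup>T * U) = frob_norm (U\<^sup>T * W * S)"
      "frob_norm (R\<^sup>T * W\<^sup>T * U) = frob_norm (U\<^sup>T * W * R)"
    using coupling_transpose[OF W] orthonormal_colsD(1)[OF S] orthonormal_colsD(1)[OF R]
      orthonormal_colsD(1)[OF U] by auto
  ultimately show ?thesis
    using coupling_left_diff_le[OF W S T U] by (simp add: frob_norm_transpose distrib_left)
qed

section \<open>Eigenvalues of a projector\<close>

text \<open>\<open>A * B\<close> and \<open>B * A\<close> have the same nonzero eigenvalues; the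
  powers of the variable balance the different sizes. Both sides come from the determinant of one
  block matrix, evaluated in two ways.\<close>

lemma char_poly_mult_commute:
  fixes A :: "'a :: idom mat"
  assumes A: "A \<in> carrier_mat n m" and B: "B \<in> carrier_mat m n"
  shows "[:0, 1:] ^ m * char_poly (A * B) = [:0, 1:] ^ n * char_poly (B * A)"
proof -
  define X :: "'a poly" where "X = [:0, 1:]"
  define A' where "A' = map_mat (\<lambda>a. [:a:]) A"
  define B' where "B' = map_mat (\<lambda>a. [:a:]) B"
  have AB': "A' \<in> carrier_mat n m" "B' \<in> carrier_mat m n"
    using A B by (auto simp: A'_def B'_def)
  have const_sum: "[:\<Sum>i\<in>I. f i:] = (\<Sum>i\<in>I. [:f i:])" for f :: "nat \<Rightarrow> 'a" and I
    by (rule poly_eqI) (simp add: coeff_sum coeff_pCons split: nat.split)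
  have cpm: "char_poly_matrix (C * D) = X \<cdot>\<^sub>m 1\<^sub>m k - map_mat (\<lambda>a. [:a:]) C * map_mat (\<lambda>a. [:a:]) D"
    if "C \<in> carrier_mat k l" "D \<in> carrier_mat l k" for C D :: "'a mat" and k l
    using that unfolding char_poly_matrix_def X_def
    by (intro eq_matI) (auto simp: scalar_prod_def const_sum mult.commute sum_negf[symmetric])
  \<comment> \<open>\<open>M\<close> is made block triangular by \<open>R\<close> from the right, leaving \<open>A * B\<close>,
    and by \<open>L\<close> from the left, leaving \<open>B * A\<close>.\<close>
  define M where "M = four_block_mat (X \<cdot>\<^sub>m 1\<^sub>m n) A' B' (1\<^sub>m m)"
  define R where "R = four_block_mat (1\<^sub>m n) (0\<^sub>m n m) (- B') (1\<^sub>m m)"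
  define L where "L = four_block_mat (1\<^sub>m n) (0\<^sub>m n m) (- B') (X \<cdot>\<^sub>m 1\<^sub>m m)"
  have carr: "M \<in> carrier_mat (n + m) (n + m)" "R \<in> carrier_mat (n + m) (n + m)"
      "L \<in> carrier_mat (n + m) (n + m)"
    using AB' by (auto simp: M_def R_def L_def)
  have "M * R = four_block_mat (X \<cdot>\<^sub>m 1\<^sub>m n * 1\<^sub>m n + A' * - B') (X \<cdot>\<^sub>m 1\<^sub>m n * 0\<^sub>m n m + A' * 1\<^sub>m m)
      (B' * 1\<^sub>m n + 1\<^sub>m m * - B') (B' * 0\<^sub>m n m + 1\<^sub>m m * 1\<^sub>m m)"
    unfolding M_def R_def by (rule mult_four_block_mat) (use AB' in auto)
  also have "\<dots> = four_block_mat (char_poly_matrix (A * B)) A' (0\<^sub>m m n) (1\<^sub>m m)"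
    unfolding cpm[OF A B] A'_def[symmetric] B'_def[symmetric]
    using AB' by (intro cong_four_block_mat) (auto simp: add_uminus_minus_mat uminus_mult_right_mat)
  finally have "det M * det R = det (four_block_mat (char_poly_matrix (A * B)) A' (0\<^sub>m m n) (1\<^sub>m m))"
    by (metis carr(1,2) det_mult)
  also have "\<dots> = char_poly (A * B)"
    by (subst det_four_block_mat_lower_left_zero) (use A B AB' in \<open>auto simp: char_poly_def\<close>)
  also have "det R = 1"
    unfolding R_def by (subst det_four_block_mat_upper_right_zero) (use AB' in auto)
  finally have 1: "char_poly (A * B) = det M"
    by simp
  have "L * M = four_block_mat (1\<^sub>m n * (X \<cdot>\<^sub>m 1\<^sub>m n) + 0\<^sub>m n m * B') (1\<^sub>m n * A' + 0\<^sub>m n m * 1\<^sub>m m)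
      (- B' * (X \<cdot>\<^sub>m 1\<^sub>m n) + X \<cdot>\<^sub>m 1\<^sub>m m * B') (- B' * A' + X \<cdot>\<^sub>m 1\<^sub>m m * 1\<^sub>m m)"
    unfolding M_def L_def by (rule mult_four_block_mat) (use AB' in auto)
  also have "\<dots> = four_block_mat (X \<cdot>\<^sub>m 1\<^sub>m n) A' (0\<^sub>m m n) (char_poly_matrix (B * A))"
    unfolding cpm[OF B A] A'_def[symmetric] B'_def[symmetric]
    using AB' by (intro cong_four_block_mat) auto
  finally have "det L * det M = det (four_block_mat (X \<cdot>\<^sub>m 1\<^sub>m n) A' (0\<^sub>m m n) (char_poly_matrix (B * A)))"
    by (metis carr(1,3) det_mult)
  also have "\<dots> = X ^ n * char_poly (B * A)"
    by (subst det_four_block_mat_lower_left_zero) (use A B AB' in \<open>auto simp: char_poly_def\<close>)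
  also have "det L = X ^ m"
    unfolding L_def by (subst det_four_block_mat_upper_right_zero) (use AB' in auto)
  finally show ?thesis
    by (simp add: 1 X_def)
qed

lemma char_poly_one: "char_poly (1\<^sub>m d :: 'a :: idom mat) = [:- 1, 1:] ^ d"
proof -
  have "char_poly_matrix (1\<^sub>m d :: 'a mat) = [:- 1, 1:] \<cdot>\<^sub>m 1\<^sub>m d"
    unfolding char_poly_matrix_def by (intro eq_matI) (auto simp: one_pCons)
  then show ?thesis
    by (simp add: char_poly_def)
qed

text \<open>\<open>V * V\<^sup>T\<close> shares its nonzero eigenvalues with
  \<open>V\<^sup>T * V\<close>, the identity of size \<open>d\<close>. Hence the spectrum is
  \<open>d\<close> ones and \<open>n - d\<close> zeros.\<close>

lemma eigenvalue_gap_projector: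
  assumes V: "V \<in> orthonormal_cols n d" and d: "1 \<le> d" "d \<le> n"
  shows "eigenvalue_gap d (V * V\<^sup>T) = 1"
proof -
  note V = orthonormal_colsD[OF V]
  have "[:0, 1:] ^ d * char_poly (V * V\<^sup>T) = [:0, 1:] ^ n * [:- 1, 1:] ^ d"
    using char_poly_mult_commute[of V n d "V\<^sup>T"] V by (simp add: char_poly_one)
  \<comment> \<open>Splitting off the power \<open>d\<close> exposes a nonzero common factor that
    can be cancelled.\<close>
  also have "\<dots> = [:0, 1:] ^ d * ([:0, 1:] ^ (n - d) * [:- 1, 1:] ^ d)"
    using d by (simp add: power_add[symmetric] mult.assoc[symmetric])
  finally have cp: "char_poly (V * V\<^sup>T) = [:0, 1:] ^ (n - d) * [:- 1, 1:] ^ d"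
    by simp
  have "proots (char_poly (V * V\<^sup>T)) = mset (replicate (n - d) 0 @ replicate d 1)"
    unfolding cp by (subst proots_mult) (auto simp: proots_power)
  then have "sorted_list_of_multiset (proots (char_poly (V * V\<^sup>T)))
      = sort (replicate (n - d) 0 @ replicate d 1)"
    by (simp only: sorted_list_of_multiset_mset)
  also have "\<dots> = replicate (n - d) 0 @ replicate d 1"
    by (intro sorted_sort_id) (auto simp: sorted_append)
  finally have "eigenvalues_decreasing (V * V\<^sup>T) = replicate d 1 @ replicate (n - d) 0"
    by (simp add: eigenvalues_decreasing_def)
  \<comment> \<open>For \<open>d = n\<close> the list ends after the ones, and the missing next
    eigenvalue is read as 0, so the gap is 1 here too.\<close>
  then show ?thesis
    using d by (auto simp: eigenvalue_gap_def nth_append)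
qed

section \<open>The gap estimate\<close>

text \<open>Each coupling term involves two neighbouring layers, so the gaps are estimated jointly
  before the largest one is isolated.\<close>

lemma gap_le_of_energy_le:
  assumes l: "0 < l"
    and W: "\<And>L. L < N \<Longrightarrow> W L \<in> carrier_mat (D (L + 1)) (D L)"
    and V: "V \<in> section_families N D d" and S: "S \<in> section_families N D d"
    and le: "energy N W V l V \<le> energy N W V l S" and M: "M \<le> N"
  shows "gap (S M) (V M) \<le> 4 * (\<Sum>L<N. (frob_norm (W L))\<^sup>2) / l"
proof -
  have V: "V L \<in> orthonormal_cols (D L) d" and S: "S L \<in> orthonormal_cols (D L) d" if "L \<le> N" for L
    using V S that by (auto simp: section_families_def)
  define a where "a L = gap (S L) (V L)" for L
  define w where "w = (\<Sum>L<N. (frob_norm (W L))\<^sup>2)"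
  have a0: "0 \<le> a L" for L
    by (simp add: a_def gap_def frob_norm_nonneg)
  have VV: "(frob_norm ((V L)\<^sup>T * V L))\<^sup>2 = d" if "L \<le> N" for L
    using orthonormal_colsD(2)[OF V[OF that]] by (simp add: frob_norm_one_sq)
  have SV: "(frob_norm ((S L)\<^sup>T * V L))\<^sup>2 = d - (a L)\<^sup>2 / 2" if "L \<le> N" for L
    using gap_sq[OF S[OF that] V[OF that]] by (simp add: a_def field_simps)
  have "l * (\<Sum>L\<le>N. (a L)\<^sup>2 / 2)
      = l * (\<Sum>L\<le>N. (frob_norm ((V L)\<^sup>T * V L))\<^sup>2) - l * (\<Sum>L\<le>N. (frob_norm ((S L)\<^sup>T * V L))\<^sup>2)"
    by (simp add: VV SV sum_subtractf algebra_simps)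
  also have "\<dots> \<le> (\<Sum>L<N. (frob_norm ((S (L + 1))\<^sup>T * W L * S L))\<^sup>2)
      - (\<Sum>L<N. (frob_norm ((V (L + 1))\<^sup>T * W L * V L))\<^sup>2)"
    using le by (simp add: energy_def)
  also have "\<dots> \<le> (\<Sum>L<N. (frob_norm (W L))\<^sup>2 * (a (L + 1) + a L))"
    unfolding sum_subtractf[symmetric] a_def
  proof (rule sum_mono)
    fix L assume "L \<in> {..<N}"
    then show "(frob_norm ((S (L + 1))\<^sup>T * W L * S L))\<^sup>2 - (frob_norm ((V (L + 1))\<^sup>T * W L * V L))\<^sup>2
        \<le> (frob_norm (W L))\<^sup>2 * (gap (S (L + 1)) (V (L + 1)) + gap (S L) (V L))"
      by (intro coupling_diff_le[OF W S V S V]) auto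
  qed
  finally have main: "l * (\<Sum>L\<le>N. (a L)\<^sup>2 / 2) \<le> (\<Sum>L<N. (frob_norm (W L))\<^sup>2 * (a (L + 1) + a L))" .
  define G where "G = Max (a ` {..N})"
  have aG: "a L \<le> G" if "L \<le> N" for L
    using that by (auto simp: G_def)
  obtain K where K: "K \<le> N" "a K = G"
    using Max_in[of "a ` {..N}"] unfolding G_def by fastforce
  \<comment> \<open>On the left only the layer \<open>K\<close> attaining the maximum is kept; on
    the right every gap is replaced by \<open>G\<close>.\<close>
  have "G\<^sup>2 / 2 \<le> (\<Sum>L\<le>N. (a L)\<^sup>2 / 2)"
    using member_le_sum[of K "{..N}" "\<lambda>L. (a L)\<^sup>2 / 2"] K by simp
  then have "l * (G\<^sup>2 / 2) \<le> l * (\<Sum>L\<le>N. (a L)\<^sup>2 / 2)"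
    using l by (intro mult_left_mono) auto
  also note main
  also have "(\<Sum>L<N. (frob_norm (W L))\<^sup>2 * (a (L + 1) + a L)) \<le> (\<Sum>L<N. (frob_norm (W L))\<^sup>2 * (2 * G))"
  proof (intro sum_mono mult_left_mono)
    show "a (L + 1) + a L \<le> 2 * G" if "L \<in> {..<N}" for L
      using aG[of L] aG[of "L + 1"] that by simp
  qed simp
  also have "\<dots> = w * (2 * G)"
    by (simp add: w_def sum_distrib_right)
  \<comment> \<open>The constant 4 is the 2 from the two neighbours of a coupling times the 2 from
    the halved squared gap.\<close>
  finally have "G * (l * G) \<le> G * (4 * w)"
    by (simp add: power2_eq_square algebra_simps)
  moreover have "0 \<le> G" "0 \<le> w"
    using K a0[of K] by (auto simp: w_def sum_nonneg)
  ultimately have "l * G \<le> 4 * w"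
    using mult_le_cancel_left_pos[of G] by (cases "G = 0") auto
  then have "G \<le> 4 * w / l"
    using l by (simp add: pos_le_divide_eq mult.commute)
  with aG[OF M] show ?thesis
    by (simp add: a_def w_def)
qed

text \<open>\<open>C\<close> is chosen before all other data and receives only the number of layers
  and the list of norms, which enforces the stated dependence.\<close>

theorem theorem1:
  shows "\<exists>C :: nat \<Rightarrow> real list \<Rightarrow> real.
    \<forall>(N :: nat) (D :: nat \<Rightarrow> nat) (d :: nat) (W :: nat \<Rightarrow> real mat) (V :: nat \<Rightarrow> real mat)
      (S :: real \<Rightarrow> nat \<Rightarrow> real mat).
      1 \<le> N \<longrightarrow>
      1 \<le> d \<longrightarrow>
      (\<forall>L\<le>N. d \<le> D L) \<longrightarrow>
      (\<forall>L<N. W L \<in> carrier_mat (D (L + 1)) (D L)) \<longrightarrow>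
      (\<forall>L\<le>N. V L \<in> orthonormal_cols (D L) d) \<longrightarrow>
      (\<forall>L<N. is_top_right_singular_subspace d (W L) (colspan (V L))) \<longrightarrow>
      (\<forall>l\<ge>0. is_arg_max (energy N W V l) (\<lambda>T. T \<in> section_families N D d) (S l)) \<longrightarrow>
      (\<exists>r :: nat \<Rightarrow> real \<Rightarrow> real.
        (\<forall>L\<le>N. r L \<in> o[at_top](\<lambda>l. 1 / l)) \<and>
        (\<forall>\<^sub>F l in at_top. \<forall>L\<le>N.
          gap (S l L) (V L)
            \<le> C N (map (\<lambda>L. frob_norm (W L)) [0..<N])
                / (l * eigenvalue_gap d (V L * (V L)\<^sup>T)) + r L l))"
proof (rule exI[of _ "\<lambda>_ ws. 4 * sum_list (map power2 ws)"], intro allI impI)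
  fix N :: nat and D :: "nat \<Rightarrow> nat" and d :: nat and W V :: "nat \<Rightarrow> real mat"
    and S :: "real \<Rightarrow> nat \<Rightarrow> real mat"
  assume d: "1 \<le> d" "\<forall>L\<le>N. d \<le> D L"
    and W: "\<forall>L<N. W L \<in> carrier_mat (D (L + 1)) (D L)"
    and V: "\<forall>L\<le>N. V L \<in> orthonormal_cols (D L) d"
    and max: "\<forall>l\<ge>0. is_arg_max (energy N W V l) (\<lambda>T. T \<in> section_families N D d) (S l)"
  let ?ws = "map (\<lambda>L. frob_norm (W L)) [0..<N]"
  have ws: "sum_list (map power2 ?ws) = (\<Sum>L<N. (frob_norm (W L))\<^sup>2)"
    by (simp add: interv_sum_list_conv_sum_set_nat comp_def atLeast0LessThan)
  have V': "V \<in> section_families N D d"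
    using V by (simp add: section_families_def)
  have bound: "gap (S l L) (V L) \<le> 4 * sum_list (map power2 ?ws) / (l * eigenvalue_gap d (V L * (V L)\<^sup>T)) + 0"
    if "0 < l" "L \<le> N" for l L
  proof -
    have S: "S l \<in> section_families N D d" and "energy N W V l V \<le> energy N W V l (S l)"
      using max that V' by (auto simp: is_arg_max_def not_less)
    then have "gap (S l L) (V L) \<le> 4 * (\<Sum>L<N. (frob_norm (W L))\<^sup>2) / l"
      using gap_le_of_energy_le[of l N W D V d "S l" L] that W V' by auto
    then show ?thesis
      using that d V eigenvalue_gap_projector[of "V L" "D L" d] by (simp only: ws)
  qed
  show "\<exists>r :: nat \<Rightarrow> real \<Rightarrow> real.
        (\<forall>L\<le>N. r L \<in> o[at_top](\<lambda>l. 1 / l)) \<and>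
        (\<forall>\<^sub>F l in at_top. \<forall>L\<le>N.
          gap (S l L) (V L)
            \<le> 4 * sum_list (map power2 ?ws) / (l * eigenvalue_gap d (V L * (V L)\<^sup>T)) + r L l)"
  \<comment> \<open>The bound is exact for every positive \<open>l\<close>, so the error term can be
    taken to be zero.\<close>
  proof (intro exI[of _ "\<lambda>_ _. 0"] conjI)
    show "\<forall>\<^sub>F l in at_top. \<forall>L\<le>N.
          gap (S l L) (V L)
            \<le> 4 * sum_list (map power2 ?ws) / (l * eigenvalue_gap d (V L * (V L)\<^sup>T)) + 0"
      using eventually_gt_at_top[of "0::real"] by eventually_elim (use bound in blast)
  qed simp
qed

end
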